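(* Let $A=(a_{i,j})$ be an $n\times n$ matrix over a field $\mathbb{F}$ of characteristic $p>0$. Then \[ \det(A)=\sum_{\substack{P\in\operatorname{PP}(n)\\ |P|\le p-1}}\operatorname{sgn}(P)\,|P|!\,\prod_{i=1}^n \begin{cases} \sum_{j\sim_P i,\ j\neq i} a_{i,j} & \text{if } i\sim_P i,\\ a_{i,i}+\sum_{j:\ j\sim_P j} a_{i,j} & \text{if } i\not\sim_P i,\end{cases} \] where $\operatorname{sgn}(P)=\prod_{S\in P}(-1)^{|S|+1}$.
   Context: A partial partition of $[n]=\{1,\dots,n\}$ is a set $P$ of pairwise disjoint nonempty subsets of $[n]$ (not necessarily covering $[n]$); $\operatorname{PP}(n)$ is the set of these; $|P|$ is the number of parts; $i\sim_P j$ means some part of $P$ contains both $i$ and $j$. Empty sums are $0$. *)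

theory Defs
  imports "Jordan_Normal_Form.Determinant" "HOL-Library.Disjoint_Sets"
begin

definition partial_partitions :: "'b set \<Rightarrow> 'b set set set" where
  "partial_partitions X = {P. \<Union>P \<subseteq> X \<and> disjoint P \<and> {} \<notin> P}"

definition same_part :: "'b set set \<Rightarrow> 'b \<Rightarrow> 'b \<Rightarrow> bool" where
  "same_part P i j \<longleftrightarrow> (\<exists>S\<in>P. i \<in> S \<and> j \<in> S)"

definition sgn_pp :: "'b set set \<Rightarrow> int" where
  "sgn_pp P = (\<Prod>S\<in>P. (-1) ^ (card S + 1))"

text \<open>Rows and columns of matrices are indexed from 0, so \<open>{0..<n}\<close> plays the role of
  \<open>{1..n}\<close> as the ground set of the partial partitions.\<close>

end

theory Submission
  imports Defs
begin

text \<open>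
  Since \<open>k!\<close> vanishes in characteristic \<open>p\<close> for \<open>k \<ge> p\<close>, the bound on the number of parts can be
  dropped, and the resulting identity holds over every commutative ring. Expanding the products,
  the coefficient of \<open>\<Prod>i. a\<^bsub>i,f i\<^esub>\<close> is the sum of \<open>sgn(P) |P|!\<close> over the partial partitions \<open>P\<close> whose
  parts are mapped into themselves by \<open>f\<close>, which avoid the fixed points of \<open>f\<close>, and whose support
  contains \<open>f i\<close> for every non-fixed \<open>i\<close> outside of it.
  If \<open>f\<close> misses a point \<open>w\<close>, moving \<open>w\<close> in and out of the part of \<open>f w\<close> is a sign-reversing
  involution. If \<open>f\<close> is a permutation, \<open>P\<close> runs over the \<open>f\<close>-invariant partitions of the non-fixed
  points, and the signed sum over invariant partitions equals \<open>sign f\<close>: delete a point \<open>x\<close> from its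
  cycle. If \<open>x\<close> is not fixed, this changes both signs; if it is fixed, then \<open>x\<close> is a part of its own
  (factor \<open>|Q| + 1\<close>) or is added to one of the \<open>|Q|\<close> parts (factor \<open>-1\<close> each).
\<close>

section \<open>Partial partitions and their weights\<close>

definition add_to_part :: "'b \<Rightarrow> 'b set \<Rightarrow> 'b set set \<Rightarrow> 'b set set" where
  "add_to_part x C Q = insert (insert x C) (Q - {C})"

text \<open>The signed factor of \<open>P\<close> in the formula, kept as an integer so that all
  cancellations take place in \<open>int\<close>, before anything is mapped into the ring.\<close>

definition weight :: "'b set set \<Rightarrow> int" where
  "weight P = sgn_pp P * fact (card P)"

lemma of_int_weight:
  "(of_int (weight P) :: 'a :: ring_1) = of_int (sgn_pp P) * of_nat (fact (card P))"
proof -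
  have "(of_int (fact (card P)) :: 'a) = of_nat (fact (card P))"
    by (metis of_int_of_nat_eq of_nat_fact)
  thus ?thesis by (simp only: weight_def of_int_mult)
qed

lemma partial_partitionsD:
  assumes "P \<in> partial_partitions X"
  shows "\<Union>P \<subseteq> X" "{} \<notin> P"
    "\<And>B C i. B \<in> P \<Longrightarrow> C \<in> P \<Longrightarrow> i \<in> B \<Longrightarrow> i \<in> C \<Longrightarrow> B = C"
  using assms unfolding partial_partitions_def disjoint_def by blast+

lemma partial_partitionsI:
  assumes "\<Union>P \<subseteq> X" "{} \<notin> P"
    "\<And>B C i. B \<in> P \<Longrightarrow> C \<in> P \<Longrightarrow> i \<in> B \<Longrightarrow> i \<in> C \<Longrightarrow> B = C"
  shows "P \<in> partial_partitions X"
  using assms unfolding partial_partitions_def disjoint_def by blast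

lemma finite_partial_partitions: "finite X \<Longrightarrow> finite (partial_partitions X)"
  by (rule finite_subset[of _ "Pow (Pow X)"]) (auto simp: partial_partitions_def)

lemma finite_partial_partition:
  assumes "finite X" "P \<in> partial_partitions X"
  shows "finite P" "B \<in> P \<Longrightarrow> finite B"
proof -
  have "P \<subseteq> Pow X" using partial_partitionsD(1)[OF assms(2)] by blast
  thus "finite P" "B \<in> P \<Longrightarrow> finite B"
    using assms(1) by (auto intro: finite_subset)
qed

lemma same_part_self_iff: "same_part P i i \<longleftrightarrow> i \<in> \<Union>P"
  by (auto simp: same_part_def)

lemma same_part_iff_mem:
  assumes "P \<in> partial_partitions X" "C \<in> P" "i \<in> C"
  shows "same_part P i j \<longleftrightarrow> j \<in> C" "same_part P j i \<longleftrightarrow> j \<in> C"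
  using partial_partitionsD(3)[OF assms(1)] assms(2,3) unfolding same_part_def by blast+

lemma same_part_in_Union: "same_part P i j \<Longrightarrow> i \<in> \<Union>P \<and> j \<in> \<Union>P"
  by (auto simp: same_part_def)

lemma Union_add_to_part: "C \<in> Q \<Longrightarrow> \<Union>(add_to_part x C Q) = insert x (\<Union>Q)"
  by (auto simp: add_to_part_def)

section \<open>Enlarging the ground set by one point\<close>

context
  fixes x :: 'b and S :: "'b set"
  assumes x: "x \<notin> S"
begin

lemma part_of_partial_partition:
  assumes "Q \<in> partial_partitions S" "C \<in> Q"
  shows "x \<notin> C" "C \<noteq> {}" "insert x C \<notin> Q" "{x} \<notin> Q" "x \<notin> \<Union>Q"
  using partial_partitionsD(1,2)[OF assms(1)] assms(2) x by blast+

lemma add_to_part_in_partial_partitions: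
  assumes Q: "Q \<in> partial_partitions S" and C: "C \<in> Q"
  shows "add_to_part x C Q \<in> partial_partitions (insert x S)"
proof (rule partial_partitionsI)
  show "\<Union>(add_to_part x C Q) \<subseteq> insert x S"
    using partial_partitionsD(1)[OF Q] Union_add_to_part[OF C] by auto
  show "{} \<notin> add_to_part x C Q"
    using partial_partitionsD(2)[OF Q] by (auto simp: add_to_part_def)
next
  fix B D i
  assume "B \<in> add_to_part x C Q" "D \<in> add_to_part x C Q" "i \<in> B" "i \<in> D"
  thus "B = D"
    using partial_partitionsD(3)[OF Q] C part_of_partial_partition(5)[OF Q C]
    unfolding add_to_part_def by blast
qed

lemma insert_singleton_in_partial_partitions:
  assumes Q: "Q \<in> partial_partitions S"
  shows "insert {x} Q \<in> partial_partitions (insert x S)"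
proof (rule partial_partitionsI)
  fix B D i
  assume "B \<in> insert {x} Q" "D \<in> insert {x} Q" "i \<in> B" "i \<in> D"
  thus "B = D"
    using partial_partitionsD(1,3)[OF Q] x by blast
qed (use partial_partitionsD(1,2)[OF Q] in auto)

text \<open>Three cases according to the position of \<open>x\<close>: covered by no part, alone in
  a part, or together with other points. In the last case, deleting \<open>x\<close> from its part
  leaves a part \<open>C\<close> of a partial partition of \<open>S\<close>.\<close>

lemma partial_partitions_insert:
  "partial_partitions (insert x S) =
     partial_partitions S \<union>
     (insert {x} ` partial_partitions S \<union>
     (\<lambda>(Q, C). add_to_part x C Q) ` (SIGMA Q:partial_partitions S. Q))" (is "_ = ?R")
proof (intro equalityI subsetI)
  fix P assume "P \<in> ?R"
  thus "P \<in> partial_partitions (insert x S)"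
  proof (elim UnE)
    assume P: "P \<in> partial_partitions S"
    show ?thesis
      by (rule partial_partitionsI) (use partial_partitionsD[OF P] in blast)+
  qed (auto intro: add_to_part_in_partial_partitions insert_singleton_in_partial_partitions)
next
  fix P assume P: "P \<in> partial_partitions (insert x S)"
  note PD = partial_partitionsD[OF P]
  show "P \<in> ?R"
  proof (cases "x \<in> \<Union>P")
    case False
    hence "P \<in> partial_partitions S"
      by (intro partial_partitionsI) (use PD in blast)+
    thus ?thesis by blast
  next
    case True
    then obtain D where D: "D \<in> P" "x \<in> D" by blast
    have uniq: "x \<notin> B" if "B \<in> P" "B \<noteq> D" for B using PD(3) D that by blast
    show ?thesis
    proof (cases "D = {x}")
      case True
      have "P - {D} \<in> partial_partitions S"
        by (rule partial_partitionsI) (use PD uniq in blast)+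
      moreover have "P = insert {x} (P - {D})" using D True by blast
      ultimately show ?thesis by blast
    next
      case False
      define C where "C = D - {x}"
      define Q where "Q = insert C (P - {D})"
      have C: "C \<noteq> {}" "x \<notin> C" "C \<subseteq> D" "insert x C = D"
        using False D by (auto simp: C_def)
      \<comment> \<open>\<open>C\<close> is a nonempty proper subset of the part \<open>D\<close>,
        so disjointness keeps it out of \<open>P\<close>. Hence removing \<open>C\<close> from
        \<open>Q\<close> gives back exactly \<open>P - {D}\<close>.\<close>
      have CP: "C \<notin> P" using PD(3) C D(1) by blast
      have "Q \<in> partial_partitions S"
      proof (rule partial_partitionsI)
        show "\<Union>Q \<subseteq> S" using PD(1) uniq C D(1) unfolding Q_def by blast
        show "{} \<notin> Q" using PD(2) C unfolding Q_def by blast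
        fix A B i assume "A \<in> Q" "B \<in> Q" "i \<in> A" "i \<in> B"
        thus "A = B" using PD(3) C D(1) unfolding Q_def by blast
      qed
      moreover have "add_to_part x C Q = P"
        using C CP D(1) unfolding add_to_part_def Q_def by auto
      moreover have "C \<in> Q" by (simp add: Q_def)
      ultimately show ?thesis by force
    qed
  qed
qed

text \<open>The only part of the result containing \<open>x\<close> is \<open>insert x C\<close>.
  Deleting \<open>x\<close> from it recovers \<open>C\<close>, and then \<open>Q\<close>.\<close>

lemma inj_on_add_to_part:
  "inj_on (\<lambda>(Q, C). add_to_part x C Q) (SIGMA Q:partial_partitions S. Q)"
proof (rule inj_onI, clarify)
  fix Q C R D
  assume Q: "Q \<in> partial_partitions S" "C \<in> Q" and R: "R \<in> partial_partitions S" "D \<in> R"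
    and eq: "add_to_part x C Q = add_to_part x D R"
  note QC = part_of_partial_partition[OF Q] and RD = part_of_partial_partition[OF R]
  have "insert x C \<in> add_to_part x D R" using eq unfolding add_to_part_def by blast
  hence "insert x C = insert x D" using RD unfolding add_to_part_def by blast
  hence CD: "C = D" using QC(1) RD(1) by (simp add: insert_ident)
  have Q_eq: "Q = insert C (add_to_part x C Q - {insert x C})"
    using QC Q unfolding add_to_part_def by blast
  have R_eq: "R = insert D (add_to_part x D R - {insert x D})"
    using RD R unfolding add_to_part_def by blast
  have "Q = R" by (metis Q_eq R_eq eq CD)
  thus "Q = R \<and> C = D" using CD by blast
qed

text \<open>The recursion behind both cancellation arguments: each \<open>Q\<close> on
  \<open>S\<close> is grouped with all its extensions by \<open>x\<close>.\<close>

lemma sum_partial_partitions_insert: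
  fixes F :: "'b set set \<Rightarrow> 'c :: comm_monoid_add"
  assumes S: "finite S"
  shows "(\<Sum>P\<in>partial_partitions (insert x S). F P) =
    (\<Sum>Q\<in>partial_partitions S. F Q + (F (insert {x} Q) + (\<Sum>C\<in>Q. F (add_to_part x C Q))))"
proof -
  let ?PP = "partial_partitions S"
  let ?A = "insert {x} ` ?PP" and ?B = "(\<lambda>(Q, C). add_to_part x C Q) ` (SIGMA Q:?PP. Q)"
  note fin = finite_partial_partitions[OF S] finite_partial_partition(1)[OF S]
  \<comment> \<open>Parts are nonempty, so \<open>insert x C\<close> is never \<open>{x}\<close>;
    this separates the third family from the second.\<close>
  have x_in_B: "x \<in> \<Union>P" "{x} \<notin> P" if "P \<in> ?B" for P
    using that part_of_partial_partition unfolding add_to_part_def by blast+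
  have x_in_A: "x \<in> \<Union>P" "{x} \<in> P" if "P \<in> ?A" for P
    using that by auto
  have x_notin: "x \<notin> \<Union>P" if "P \<in> ?PP" for P
    using partial_partitionsD(1)[OF that] x by blast
  have disj: "?PP \<inter> (?A \<union> ?B) = {}" "?A \<inter> ?B = {}"
    unfolding disjoint_iff Un_iff using x_in_A x_in_B x_notin by metis+
  have "inj_on (insert {x}) ?PP"
  proof (rule inj_onI)
    fix Q R assume QR: "Q \<in> ?PP" "R \<in> ?PP" and eq: "insert {x} Q = insert {x} R"
    have "{x} \<notin> Q" "{x} \<notin> R"
      using x_notin[OF QR(1)] x_notin[OF QR(2)] by auto
    thus "Q = R" using eq by (simp add: insert_ident)
  qed
  hence A: "sum F ?A = (\<Sum>Q\<in>?PP. F (insert {x} Q))"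
    by (simp add: sum.reindex)
  have B: "sum F ?B = (\<Sum>Q\<in>?PP. \<Sum>C\<in>Q. F (add_to_part x C Q))"
    using inj_on_add_to_part fin
    by (simp add: sum.reindex sum.Sigma case_prod_unfold)
  have "finite ?A" "finite ?B"
    using fin by (auto intro!: finite_imageI finite_SigmaI)
  thus ?thesis
    unfolding partial_partitions_insert using disj fin A B
    by (simp add: sum.union_disjoint sum.distrib)
qed

text \<open>A singleton has sign 1, so only the factorial changes.\<close>

lemma weight_insert_singleton:
  assumes "finite S" "Q \<in> partial_partitions S"
  shows "weight (insert {x} Q) = int (card Q + 1) * weight Q"
proof -
  have "{x} \<notin> Q" using partial_partitionsD(1)[OF assms(2)] x by blast
  thus ?thesis
    using finite_partial_partition(1)[OF assms]
    by (simp add: weight_def sgn_pp_def algebra_simps)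
qed

text \<open>The number of parts stays the same while one part grows by one element, which flips its
  sign.\<close>

lemma weight_add_to_part:
  assumes S: "finite S" and Q: "Q \<in> partial_partitions S" and C: "C \<in> Q"
  shows "weight (add_to_part x C Q) = - weight Q"
proof -
  define R where "R = Q - {C}"
  have fin: "finite R" "finite C"
    using finite_partial_partition[OF S Q] C by (auto simp: R_def)
  have notin: "insert x C \<notin> R" "x \<notin> C" "C \<notin> R"
    using part_of_partial_partition[OF Q C] by (auto simp: R_def)
  have eq: "Q = insert C R" "add_to_part x C Q = insert (insert x C) R"
    using C by (auto simp: R_def add_to_part_def)
  have "card (add_to_part x C Q) = card Q"
    unfolding eq(2) using eq(1) fin notin by simp
  moreover have "sgn_pp (add_to_part x C Q) = - sgn_pp Q"
    unfolding eq(2) using eq(1) fin notin by (simp add: sgn_pp_def)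
  ultimately show ?thesis by (simp add: weight_def)
qed

lemma same_part_add_to_part:
  assumes Q: "Q \<in> partial_partitions S" and C: "C \<in> Q"
  shows "i \<noteq> x \<Longrightarrow> j \<noteq> x \<Longrightarrow> same_part (add_to_part x C Q) i j \<longleftrightarrow> same_part Q i j"
    and "i \<noteq> x \<Longrightarrow> same_part (add_to_part x C Q) i x \<longleftrightarrow> i \<in> C"
    and "i \<noteq> x \<Longrightarrow> same_part (add_to_part x C Q) x i \<longleftrightarrow> i \<in> C"
    and "same_part (add_to_part x C Q) x x"
  using part_of_partial_partition[OF Q C] C unfolding same_part_def add_to_part_def by blast+

end

section \<open>Signed count of the partitions invariant under a permutation\<close>

definition invariant_partition :: "'b set \<Rightarrow> ('b \<Rightarrow> 'b) \<Rightarrow> 'b set set \<Rightarrow> bool" where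
  "invariant_partition S f P \<longleftrightarrow> \<Union>P = S \<and> (\<forall>i\<in>S. same_part P (f i) i)"

text \<open>Disjointness leaves exactly one part containing \<open>b\<close>.\<close>

lemma sum_over_part_containing:
  assumes "finite S" "Q \<in> partial_partitions S" "b \<in> \<Union>Q"
  shows "(\<Sum>C\<in>Q. if b \<in> C then a else 0) = (a :: int)"
proof -
  obtain D where D: "D \<in> Q" "b \<in> D" using assms(3) by blast
  have "(\<Sum>C\<in>Q. if b \<in> C then a else 0) = (\<Sum>C\<in>Q. if C = D then a else 0)"
    by (rule sum.cong) (use D partial_partitionsD(3)[OF assms(2)] in auto)
  thus ?thesis using D finite_partial_partition(1)[OF assms(1,2)] by simp
qed

text \<open>Here \<open>q\<close> fixes \<open>x\<close>, so the condition at \<open>x\<close> only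
  asks that \<open>x\<close> be covered, and the conditions on \<open>S\<close> do not see
  \<open>x\<close>.\<close>

lemma invariant_partition_insert_fixed_point:
  assumes x: "x \<notin> S" and q: "q permutes S" and Q: "Q \<in> partial_partitions S"
  shows "\<not> invariant_partition (insert x S) q Q"
    and "invariant_partition (insert x S) q (insert {x} Q) \<longleftrightarrow> invariant_partition S q Q"
    and "C \<in> Q \<Longrightarrow>
      invariant_partition (insert x S) q (add_to_part x C Q) \<longleftrightarrow> invariant_partition S q Q"
proof -
  have U: "x \<notin> \<Union>Q" using partial_partitionsD(1)[OF Q] x by blast
  have qx: "q x = x" using permutes_not_in[OF q x] .
  have qS: "q i \<in> S \<and> q i \<noteq> x \<and> i \<noteq> x" if "i \<in> S" for i
    using permutes_in_image[OF q] x that by metis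
  show "\<not> invariant_partition (insert x S) q Q"
    using U by (auto simp: invariant_partition_def)
  have "\<Union>(insert {x} Q) = insert x S \<longleftrightarrow> \<Union>Q = S"
    using U x by auto
  moreover have "same_part (insert {x} Q) (q i) i \<longleftrightarrow> same_part Q (q i) i" if "i \<in> S" for i
    using qS[OF that] by (auto simp: same_part_def)
  ultimately show
    "invariant_partition (insert x S) q (insert {x} Q) \<longleftrightarrow> invariant_partition S q Q"
    by (auto simp: invariant_partition_def qx same_part_self_iff)
  assume C: "C \<in> Q"
  have "\<Union>(add_to_part x C Q) = insert x S \<longleftrightarrow> \<Union>Q = S"
    unfolding Union_add_to_part[OF C] using U x by auto
  thus "invariant_partition (insert x S) q (add_to_part x C Q) \<longleftrightarrow> invariant_partition S q Q"
    using qS same_part_add_to_part[OF x Q C] by (auto simp: invariant_partition_def qx)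
qed

text \<open>Composing with the transposition splices \<open>x\<close> into a cycle of
  \<open>q\<close> just before \<open>b\<close>: \<open>x\<close> goes to \<open>b\<close>, and the
  \<open>q\<close>-preimage of \<open>b\<close> goes to \<open>x\<close>. So \<open>x\<close> must
  be covered, and by the part of \<open>b\<close>.\<close>

lemma invariant_partition_insert_transpose:
  assumes x: "x \<notin> S" and b: "b \<in> S" and q: "q permutes S" and Q: "Q \<in> partial_partitions S"
  shows "\<not> invariant_partition (insert x S) (transpose x b \<circ> q) Q"
    and "\<not> invariant_partition (insert x S) (transpose x b \<circ> q) (insert {x} Q)"
    and "C \<in> Q \<Longrightarrow>
      invariant_partition (insert x S) (transpose x b \<circ> q) (add_to_part x C Q) \<longleftrightarrow>
      invariant_partition S q Q \<and> b \<in> C"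
proof -
  let ?f = "transpose x b \<circ> q"
  have U: "x \<notin> \<Union>Q" using partial_partitionsD(1)[OF Q] x by blast
  have bx: "b \<noteq> x" using b x by blast
  have fx: "?f x = b" using permutes_not_in[OF q x] by simp
  have qS: "q i \<in> S \<and> q i \<noteq> x \<and> i \<noteq> x" if "i \<in> S" for i
    using permutes_in_image[OF q] x that by metis
  have fS: "?f i = (if q i = b then x else q i)" if "i \<in> S" for i
    using qS[OF that] by (auto simp: transpose_def)
  show "\<not> invariant_partition (insert x S) ?f Q"
    using U by (auto simp: invariant_partition_def)
  show "\<not> invariant_partition (insert x S) ?f (insert {x} Q)"
    using U fx bx by (auto simp: invariant_partition_def same_part_def)
  assume C: "C \<in> Q"
  note sp = same_part_add_to_part[OF x Q C]
  have Un: "\<Union>(add_to_part x C Q) = insert x S \<longleftrightarrow> \<Union>Q = S"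
    unfolding Union_add_to_part[OF C] using U x by auto
  have at_x: "same_part (add_to_part x C Q) (?f x) x \<longleftrightarrow> b \<in> C"
    unfolding fx using sp(2) bx by blast
  have at_S: "same_part (add_to_part x C Q) (?f i) i \<longleftrightarrow> same_part Q (q i) i"
    if "i \<in> S" "b \<in> C" for i
    using fS[OF that(1)] qS[OF that(1)] sp same_part_iff_mem(1)[OF Q C that(2)] by auto
  show "invariant_partition (insert x S) ?f (add_to_part x C Q) \<longleftrightarrow>
      invariant_partition S q Q \<and> b \<in> C"
    unfolding invariant_partition_def Un using at_x at_S by auto
qed

lemma sum_weight_invariant_partitions:
  assumes "finite S" "f permutes S"
  shows "(\<Sum>P\<in>partial_partitions S. if invariant_partition S f P then weight P else 0) = sign f"
  using assms
proof (induction S arbitrary: f rule: finite_induct)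
  case empty
  have "partial_partitions {} = {{} :: 'a set set}"
    by (auto simp: partial_partitions_def)
  thus ?case using empty by (simp add: invariant_partition_def weight_def sgn_pp_def)
next
  case (insert x S)
  note fin = insert.hyps(1) and x = insert.hyps(2)
  \<comment> \<open>Since \<open>q\<close> fixes \<open>x\<close>, necessarily
    \<open>b = f x\<close>, and \<open>q\<close> is \<open>f\<close> with \<open>x\<close> deleted
    from its cycle.\<close>
  obtain b q where bq: "f = transpose x b \<circ> q" "b \<in> insert x S" "q permutes S"
  proof -
    have "f \<in> {p. p permutes insert x S}" using insert.prems by simp
    thus ?thesis using that unfolding permutes_insert by auto
  qed
  let ?F = "\<lambda>P. if invariant_partition (insert x S) f P then weight P else 0"
  let ?G = "\<lambda>Q. if invariant_partition S q Q then weight Q else 0"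
  have perm: "permutation q" using fin bq(3) permutation_permutes by blast
  show ?case
  proof (cases "b = x")
    case True
    hence f: "f = q" using bq(1) by simp
    \<comment> \<open>For invariant \<open>Q\<close> the extensions contribute
      \<open>card Q + 1\<close> and \<open>- card Q\<close> times the weight of
      \<open>Q\<close>.\<close>
    have "?F Q + (?F (insert {x} Q) + (\<Sum>C\<in>Q. ?F (add_to_part x C Q))) = ?G Q"
      if Q: "Q \<in> partial_partitions S" for Q
      using invariant_partition_insert_fixed_point[OF x bq(3) Q]
        weight_insert_singleton[OF x fin Q] weight_add_to_part[OF x fin Q]
      by (simp add: f algebra_simps)
    thus ?thesis
      using insert.IH[OF bq(3)] by (simp add: sum_partial_partitions_insert[OF x fin] f)
  next
    case False
    hence b: "b \<in> S" using bq(2) by blast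
    note inv = invariant_partition_insert_transpose[OF x b bq(3), folded bq(1)]
    have "?F Q + (?F (insert {x} Q) + (\<Sum>C\<in>Q. ?F (add_to_part x C Q))) = - ?G Q"
      if Q: "Q \<in> partial_partitions S" for Q
    proof -
      \<comment> \<open>Only the part containing \<open>b\<close> can receive \<open>x\<close>, so
        one term survives, with the opposite weight.\<close>
      have "(\<Sum>C\<in>Q. ?F (add_to_part x C Q)) =
          (\<Sum>C\<in>Q. if b \<in> C then - ?G Q else 0)"
        using inv(3)[OF Q] weight_add_to_part[OF x fin Q] by (intro sum.cong) auto
      also have "\<dots> = - ?G Q"
      proof (cases "invariant_partition S q Q")
        case True
        hence "b \<in> \<Union>Q" using b by (simp add: invariant_partition_def)
        from sum_over_part_containing[OF fin Q this] show ?thesis .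
      qed (simp cong: if_cong)
      finally show ?thesis using inv(1,2)[OF Q] by simp
    qed
    hence "(\<Sum>P\<in>partial_partitions (insert x S). ?F P) = - sign q"
      using insert.IH[OF bq(3)]
      by (simp add: sum_partial_partitions_insert[OF x fin] sum_negf)
    also have "\<dots> = sign f"
      using False perm by (simp add: bq(1) sign_compose permutation_swap_id sign_swap_id)
    finally show ?thesis .
  qed
qed

section \<open>Partial partitions compatible with a function\<close>

text \<open>The functions \<open>f\<close> whose monomial occurs in the expansion of the product belonging to \<open>P\<close>.\<close>

definition compatible :: "'b set \<Rightarrow> ('b \<Rightarrow> 'b) \<Rightarrow> 'b set set \<Rightarrow> bool" where
  "compatible S f P \<longleftrightarrow> (\<forall>i\<in>S. if i \<in> \<Union>P then same_part P (f i) i \<and> f i \<noteq> i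
     else f i = i \<or> f i \<in> \<Union>P)"

text \<open>As no point is mapped to \<open>w\<close>, covering \<open>w\<close> or not affects only
  the condition at \<open>w\<close> itself. Uncovered, it asks for \<open>f w\<close> in the
  support; covered, it puts \<open>w\<close> into the part of \<open>f w\<close>. These two options
  cancel.\<close>

lemma sum_weight_compatible_not_surj:
  assumes fin: "finite S" and f: "f ` S \<subseteq> S" and w: "w \<in> S" "w \<notin> f ` S"
  shows "(\<Sum>P\<in>partial_partitions S. if compatible S f P then weight P else 0) = 0"
proof -
  define T where "T = S - {w}"
  have S: "S = insert w T" and wT: "w \<notin> T" and finT: "finite T"
    using w fin by (auto simp: T_def)
  have fS: "f i \<in> T" "f i \<noteq> w" if "i \<in> S" for i
    using f w that by (auto simp: T_def)
  let ?F = "\<lambda>P. if compatible S f P then weight P else 0"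
  have "?F Q + (?F (insert {w} Q) + (\<Sum>C\<in>Q. ?F (add_to_part w C Q))) = 0"
    if Q: "Q \<in> partial_partitions T" for Q
  proof -
    have U: "w \<notin> \<Union>Q" using partial_partitionsD(1)[OF Q] wT by blast
    \<comment> \<open>A part \<open>{w}\<close> would force \<open>f w = w\<close>, although
      \<open>w\<close> is not a value of \<open>f\<close>.\<close>
    have singleton: "\<not> compatible S f (insert {w} Q)"
      using U w(1) by (auto simp: compatible_def same_part_def intro!: bexI[of _ w])
    have "compatible S f (add_to_part w C Q) \<longleftrightarrow> compatible S f Q \<and> f w \<in> C"
      if C: "C \<in> Q" for C
    proof -
      note sp = same_part_add_to_part[OF wT Q C]
      have "i \<in> \<Union>(add_to_part w C Q) \<longleftrightarrow> i = w \<or> i \<in> \<Union>Q" for i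
        using Union_add_to_part[OF C] by auto
      moreover have "i \<noteq> w" if "i \<in> T" for i using that wT by blast
      ultimately show ?thesis
        unfolding compatible_def S using fS U w(1) C sp by (auto simp: S)
    qed
    hence "(\<Sum>C\<in>Q. ?F (add_to_part w C Q)) = (\<Sum>C\<in>Q. if f w \<in> C then - ?F Q else 0)"
      using weight_add_to_part[OF wT finT Q] by (intro sum.cong) auto
    also have "\<dots> = - ?F Q"
    proof (cases "compatible S f Q")
      case True
      hence "f w \<in> \<Union>Q" using U w(1) fS(2)[OF w(1)] by (auto simp: compatible_def)
      from sum_over_part_containing[OF finT Q this] show ?thesis .
    qed (simp cong: if_cong)
    finally show ?thesis using singleton by simp
  qed
  thus ?thesis
    by (subst (1) S) (simp add: sum_partial_partitions_insert[OF wT finT])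
qed

text \<open>For a permutation, compatibility forces the support to be the set \<open>N\<close> of
  non-fixed points, which reduces the sum to invariant partitions of \<open>N\<close>.\<close>

lemma sum_weight_compatible_permutes:
  assumes fin: "finite S" and f: "f permutes S"
  shows "(\<Sum>P\<in>partial_partitions S. if compatible S f P then weight P else 0) = sign f"
proof -
  define N where "N = {i \<in> S. f i \<noteq> i}"
  have N: "N \<subseteq> S" "finite N" using fin by (auto simp: N_def)
  have fN: "f permutes N"
    by (rule permutes_superset[OF f]) (auto simp: N_def)
  have iff: "compatible S f P \<longleftrightarrow> P \<in> partial_partitions N \<and> invariant_partition N f P"
    if P: "P \<in> partial_partitions S" for P
  proof
    assume comp: "compatible S f P"
    have PS: "\<Union>P \<subseteq> S" using partial_partitionsD(1)[OF P] .
    have closed: "same_part P (f i) i" "f i \<noteq> i" if "i \<in> \<Union>P" for i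
    proof -
      have "i \<in> S" using that PS by blast
      thus "same_part P (f i) i" "f i \<noteq> i"
        using comp that unfolding compatible_def by (metis (no_types))+
    qed
    \<comment> \<open>The support is finite and mapped into itself injectively, hence onto itself.
      So no outside point is mapped into it, and every outside point must be fixed.\<close>
    have "f ` \<Union>P = \<Union>P"
    proof (rule endo_inj_surj)
      show "finite (\<Union>P)" using PS fin by (rule finite_subset)
      show "f ` \<Union>P \<subseteq> \<Union>P" using closed(1) same_part_in_Union by (metis image_subsetI)
      show "inj_on f (\<Union>P)" using permutes_inj_on[OF f] .
    qed
    hence pre: "i \<in> \<Union>P" if "f i \<in> \<Union>P" for i
      using that permutes_inj[OF f] by (metis imageE injD)
    have "i \<in> \<Union>P" if "i \<in> N" for i
    proof -
      have "i \<in> S" "f i \<noteq> i" using that by (auto simp: N_def)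
      thus ?thesis using comp pre unfolding compatible_def by (metis (no_types))
    qed
    moreover have "\<Union>P \<subseteq> N" using closed(2) PS by (auto simp: N_def)
    ultimately have "\<Union>P = N" by blast
    thus "P \<in> partial_partitions N \<and> invariant_partition N f P"
      using P closed(1) by (auto simp: invariant_partition_def partial_partitions_def)
  next
    assume "P \<in> partial_partitions N \<and> invariant_partition N f P"
    thus "compatible S f P"
      by (auto simp: invariant_partition_def compatible_def N_def)
  qed
  have "(\<Sum>P\<in>partial_partitions S. if compatible S f P then weight P else 0) =
      (\<Sum>P\<in>partial_partitions N. if invariant_partition N f P then weight P else 0)"
  proof (rule sum.mono_neutral_cong_right)
    show "partial_partitions N \<subseteq> partial_partitions S"
      using N(1) by (auto simp: partial_partitions_def)
  qed (use finite_partial_partitions[OF fin] iff N(1) in \<open>auto simp: partial_partitions_def\<close>)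
  thus ?thesis using sum_weight_invariant_partitions[OF N(2) fN] by simp
qed

section \<open>Expansion over functions and comparison with the determinant\<close>

lemma sum_PiE_permutes:
  fixes c :: "('b \<Rightarrow> 'b) \<Rightarrow> 'c :: comm_ring_1"
  assumes fin: "finite S"
    and zero: "\<And>f. f ` S \<subseteq> S \<Longrightarrow> f ` S \<noteq> S \<Longrightarrow> c f = 0"
    and cong: "\<And>f h. (\<And>i. i \<in> S \<Longrightarrow> f i = h i) \<Longrightarrow> c f = c h"
  shows "(\<Sum>f\<in>S \<rightarrow>\<^sub>E S. c f) = (\<Sum>f | f permutes S. c f)"
proof -
  let ?B = "{f \<in> S \<rightarrow>\<^sub>E S. f ` S = S}"
  have "(\<Sum>f\<in>S \<rightarrow>\<^sub>E S. c f) = (\<Sum>f\<in>?B. c f)"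
    using fin by (intro sum.mono_neutral_right) (auto intro!: zero finite_PiE)
  also have "\<dots> = (\<Sum>f | f permutes S. c f)"
  \<comment> \<open>Extensional functions are \<open>undefined\<close> outside \<open>S\<close>,
    permutations are the identity there. The two witnesses switch between these conventions, and
    \<open>cong\<close> says that \<open>c\<close> ignores the difference.\<close>
  proof (rule sum.reindex_bij_witness[where j = "\<lambda>f i. if i \<in> S then f i else i"
        and i = "\<lambda>f. restrict f S"])
    fix f assume f: "f \<in> ?B"
    show "restrict (\<lambda>i. if i \<in> S then f i else i) S = f"
      using f by (auto simp: fun_eq_iff PiE_iff extensional_def)
    have "bij_betw f S S"
      using f finite_surj_inj[OF fin, of f] by (auto simp: bij_betw_def)
    hence "bij_betw (\<lambda>i. if i \<in> S then f i else i) S S"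
      by (rule bij_betw_cong[THEN iffD1, rotated]) auto
    thus "(\<lambda>i. if i \<in> S then f i else i) \<in> {f. f permutes S}"
      by (auto intro: bij_imp_permutes)
    show "c (\<lambda>i. if i \<in> S then f i else i) = c f"
      by (rule cong) auto
  next
    fix f assume "f \<in> {f. f permutes S}"
    hence f: "f permutes S" by simp
    show "(\<lambda>i. if i \<in> S then restrict f S i else i) = f"
      using permutes_not_in[OF f] by (auto simp: fun_eq_iff)
    show "restrict f S \<in> ?B"
      using permutes_image[OF f] permutes_in_image[OF f] by auto
  qed
  finally show ?thesis .
qed

text \<open>Multiplying out each product and exchanging the two sums leaves, for each
  \<open>f\<close>, the coefficient \<open>c f\<close>, which is the sign of \<open>f\<close> for
  permutations and 0 for the other self-maps.\<close>

theorem det_eq_sum_partial_partitions: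
  fixes A :: "'a :: comm_ring_1 mat"
  assumes A: "A \<in> carrier_mat n n"
  shows "det A =
    (\<Sum>P\<in>partial_partitions {0..<n}. of_int (weight P) *
      (\<Prod>i = 0..<n.
        if same_part P i i
        then (\<Sum>j | j \<in> {0..<n} \<and> same_part P j i \<and> j \<noteq> i. A $$ (i, j))
        else A $$ (i, i) + (\<Sum>j | j \<in> {0..<n} \<and> same_part P j j. A $$ (i, j))))"
proof -
  let ?S = "{0..<n}"
  \<comment> \<open>The columns that row \<open>i\<close> may use for \<open>P\<close>. Choosing one
    from each row is the same as choosing an \<open>f\<close> with
    \<open>compatible ?S f P\<close>.\<close>
  define J where "J P i = {j \<in> ?S. if i \<in> \<Union>P then same_part P j i \<and> j \<noteq> i
      else j = i \<or> j \<in> \<Union>P}" for P i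
  define c where "c f = (\<Sum>P\<in>partial_partitions ?S. if compatible ?S f P then weight P else 0)"
    for f
  let ?m = "\<lambda>f. \<Prod>i\<in>?S. A $$ (i, f i)"
  have finJ: "finite (J P i)" for P i by (simp add: J_def)
  have factor: "(if same_part P i i
        then (\<Sum>j | j \<in> ?S \<and> same_part P j i \<and> j \<noteq> i. A $$ (i, j))
        else A $$ (i, i) + (\<Sum>j | j \<in> ?S \<and> same_part P j j. A $$ (i, j))) =
      (\<Sum>j\<in>J P i. A $$ (i, j))" if "i \<in> ?S" for P i
  proof (cases "i \<in> \<Union>P")
    case True
    hence "J P i = {j. j \<in> ?S \<and> same_part P j i \<and> j \<noteq> i}" by (auto simp: J_def)
    thus ?thesis using True by (simp add: same_part_self_iff)
  next
    case False
    \<comment> \<open>An uncovered \<open>i\<close> does not occur in the second set, so the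
      diagonal entry is counted once.\<close>
    hence "J P i = insert i {j. j \<in> ?S \<and> same_part P j j}"
      using that by (auto simp: J_def same_part_self_iff)
    thus ?thesis using False by (simp add: same_part_self_iff)
  qed
  have expand: "(\<Prod>i\<in>?S. \<Sum>j\<in>J P i. A $$ (i, j)) =
      (\<Sum>f\<in>?S \<rightarrow>\<^sub>E ?S. if compatible ?S f P then ?m f else 0)" for P
  proof -
    have "(\<Prod>i\<in>?S. \<Sum>j\<in>J P i. A $$ (i, j)) = (\<Sum>f\<in>PiE ?S (J P). ?m f)"
      using finJ by (intro prod_sum_PiE) auto
    also have "PiE ?S (J P) = {f \<in> ?S \<rightarrow>\<^sub>E ?S. compatible ?S f P}"
      unfolding J_def compatible_def set_eq_iff PiE_iff mem_Collect_eq by blast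
    also have "(\<Sum>f\<in>\<dots>. ?m f) = (\<Sum>f\<in>?S \<rightarrow>\<^sub>E ?S. if compatible ?S f P then ?m f else 0)"
      by (rule sum.inter_filter) (auto intro: finite_PiE)
    finally show ?thesis .
  qed
  have "(\<Sum>P\<in>partial_partitions ?S. of_int (weight P) *
      (\<Prod>i = 0..<n.
        if same_part P i i
        then (\<Sum>j | j \<in> ?S \<and> same_part P j i \<and> j \<noteq> i. A $$ (i, j))
        else A $$ (i, i) + (\<Sum>j | j \<in> ?S \<and> same_part P j j. A $$ (i, j)))) =
      (\<Sum>P\<in>partial_partitions ?S. of_int (weight P) *
        (\<Sum>f\<in>?S \<rightarrow>\<^sub>E ?S. if compatible ?S f P then ?m f else 0))"
    unfolding expand[symmetric]
    by (intro sum.cong refl arg_cong2[where f = "(*)"] prod.cong factor)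
  also have "\<dots> = (\<Sum>P\<in>partial_partitions ?S. \<Sum>f\<in>?S \<rightarrow>\<^sub>E ?S.
      of_int (if compatible ?S f P then weight P else 0) * ?m f)"
    unfolding sum_distrib_left by (intro sum.cong) auto
  also have "\<dots> = (\<Sum>f\<in>?S \<rightarrow>\<^sub>E ?S. of_int (c f) * ?m f)"
    unfolding c_def of_int_sum sum_distrib_right by (rule sum.swap)
  also have "\<dots> = (\<Sum>f | f permutes ?S. of_int (c f) * ?m f)"
  proof (rule sum_PiE_permutes)
    fix f :: "nat \<Rightarrow> nat" assume f: "f ` ?S \<subseteq> ?S" "f ` ?S \<noteq> ?S"
    then obtain w where "w \<in> ?S" "w \<notin> f ` ?S" by blast
    with f(1) have "c f = 0"
      unfolding c_def by (intro sum_weight_compatible_not_surj) auto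
    thus "of_int (c f) * ?m f = 0" by simp
  next
    fix f h :: "nat \<Rightarrow> nat" assume eq: "\<And>i. i \<in> ?S \<Longrightarrow> f i = h i"
    hence "compatible ?S f P = compatible ?S h P" for P
      by (simp add: compatible_def)
    hence "c f = c h" by (simp add: c_def)
    moreover have "?m f = ?m h" using eq by (intro prod.cong) auto
    ultimately show "of_int (c f) * ?m f = of_int (c h) * ?m h" by simp
  qed simp
  also have "\<dots> = (\<Sum>f | f permutes ?S. signof f * ?m f)"
    by (intro sum.cong) (auto simp: c_def sum_weight_compatible_permutes)
  also have "\<dots> = det A" using A by (simp add: det_def')
  finally show ?thesis by simp
qed

section \<open>Restriction to few parts in positive characteristic\<close>

theorem theorem5p1:
  fixes A :: "'a :: field mat" and n p :: nat
  assumes "A \<in> carrier_mat n n"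
    and "CHAR('a) = p" and "p > 0"
  shows "det A =
    (\<Sum>P | P \<in> partial_partitions {0..<n} \<and> card P \<le> p - 1.
      of_int (sgn_pp P) * of_nat (fact (card P)) *
      (\<Prod>i = 0..<n.
        if same_part P i i
        then (\<Sum>j | j \<in> {0..<n} \<and> same_part P j i \<and> j \<noteq> i. A $$ (i, j))
        else A $$ (i, i) + (\<Sum>j | j \<in> {0..<n} \<and> same_part P j j. A $$ (i, j))))"
proof -
  \<comment> \<open>With \<open>p > 0\<close> the truncated \<open>p - 1\<close> is harmless: the
    assumption means \<open>p \<le> card P\<close>, so \<open>p\<close> is a factor of the
    factorial.\<close>
  have "of_nat (fact (card P)) = (0 :: 'a)" if "\<not> card P \<le> p - 1" for P :: "nat set set"
    unfolding of_nat_eq_0_iff_char_dvd using that assms(2,3) by (intro dvd_fact) auto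
  hence zero: "of_int (weight P) = (0 :: 'a)" if "\<not> card P \<le> p - 1" for P :: "nat set set"
    using that by (simp add: of_int_weight)
  show ?thesis
    unfolding det_eq_sum_partial_partitions[OF assms(1)]
    by (rule sum.mono_neutral_cong_right)
      (use zero in \<open>auto simp: of_int_weight finite_partial_partitions\<close>)
qed

end
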